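(* For all real $x$ with $-\frac13\le x\le 1$, $$\begin{aligned}\sum_{n=1}^{\infty} H_n^- \frac{x^{n+1}}{(n+1)^2} ={}& \operatorname{Li}_3\left(\frac{2x}{1+x}\right)-\operatorname{Li}_3\left(\frac{x}{1+x}\right)-\operatorname{Li}_3\left(\frac{1+x}{2}\right)+\operatorname{Li}_3\left(\frac{1}{2}\right)-\operatorname{Li}_3(x) \\ &+\log(1+x)\left[\operatorname{Li}_2(x)+\operatorname{Li}_2\left(\frac{1}{2}\right)+\frac{1}{2}\log 2\,\log(1+x)\right].\end{aligned}$$
   Context: The skew-harmonic numbers are $H_n^- =\sum_{k=1}^n \frac{(-1)^{k-1}}{k}$ for $n\ge 1$. $\operatorname{Li}_m(t)=\sum_{n=1}^\infty \frac{t^n}{n^m}$ for $|t|\le 1$, $m=2,3$. $\log$ is the natural logarithm. *)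

theory Defs
  imports "HOL-Analysis.Analysis"
begin

definition skew_harm :: "nat \<Rightarrow> real" where
  "skew_harm n = (\<Sum>k=1..n. (-1) ^ (k - 1) / real k)"

(* Intended for \<bar>t\<bar> \<le> 1 and m \<ge> 2, where the series converges.
   The summation index is shifted to start at 0. *)
definition Li :: "nat \<Rightarrow> real \<Rightarrow> real" where
  "Li m t = (\<Sum>n. t ^ (n + 1) / real (n + 1) ^ m)"

end

theory Submission
  imports Defs
begin

text \<open>
  Write \<open>F x\<close> for the series, \<open>H\<close> for the sequence of skew-harmonic numbers and \<open>R x\<close> for the
  closed form. Both are continuous on \<open>[-1/3, 1]\<close>, because there every argument of a dilogarithm or
  trilogarithm stays in \<open>[-1, 1]\<close>; the left end is the point where \<open>2 x / (1 + x) = -1\<close>. Both vanish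
  at \<open>0\<close>. So it is enough to compare the derivatives at interior points \<open>x \<noteq> 0\<close>, and continuity
  settles the points \<open>-1/3\<close>, \<open>0\<close> and \<open>1\<close> (\<open>has_real_derivative_zero_off_finite_unique\<close>).

  On the left, \<open>x F' x\<close> is the series \<open>G x = (\<Sum>n. H n x^(n+1) / (n+1))\<close>. Since consecutive
  skew-harmonic numbers differ by the coefficients of \<open>ln (1 + x)\<close>, one has
  \<open>(\<Sum>n. H n x^n) = ln (1 + x) / (1 - x)\<close> (\<open>skew_harm_powser\<close>). Integrating this by parts gives
  \<open>G x = ln (1 + x) (ln 2 - ln (1 - x)) - Li 2 ((1 + x) / 2) + Li 2 (1 / 2)\<close>
  (\<open>skew_harm_weighted_polylog_1\<close>).

  On the right, each trilogarithm of a rational function \<open>u\<close> contributes \<open>Li 2 u \<cdot> u' / u\<close>, and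
  \<open>u' / u\<close> equals \<open>1 / (x (1 + x))\<close> for \<open>2 x / (1 + x)\<close> as well as for \<open>x / (1 + x)\<close>. Hence
  only the difference of the dilogarithms at these two arguments enters \<open>R'\<close>. A dilogarithm identity
  (\<open>dilogarithm_identity\<close>) expresses it through the values at \<open>x\<close>, \<open>(1 + x) / 2\<close> and \<open>1/2\<close>, which
  turns \<open>R' x\<close> into \<open>G x / x\<close>. The identity is itself proved by comparing derivatives.
\<close>

section \<open>Polylogarithms with bounded weights\<close>

text \<open>
  The series \<open>F\<close> and \<open>G\<close> and all polylogarithms have this form, with skew-harmonic or constant
  weights, so that convergence, continuity and differentiation need only be treated once.
\<close>

definition weighted_polylog :: "(nat \<Rightarrow> real) \<Rightarrow> nat \<Rightarrow> real \<Rightarrow> real" where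
  "weighted_polylog a m x = (\<Sum>n. a n * (x ^ (n + 1) / real (n + 1) ^ m))"

lemma Li_eq_weighted_polylog: "Li m x = weighted_polylog (\<lambda>_. 1) m x"
  by (simp add: Li_def weighted_polylog_def)

lemma weighted_polylog_at_0 [simp]: "weighted_polylog a m 0 = 0"
  by (simp add: weighted_polylog_def)

lemma Li_at_0 [simp]: "Li m 0 = 0"
  by (simp add: Li_eq_weighted_polylog)

lemma summable_bounded_coeffs_powser:
  fixes x :: real
  assumes "Bseq a" and "\<bar>x\<bar> < 1"
  shows "summable (\<lambda>n. a n / real (n + 1) ^ m * x ^ n)"
proof -
  obtain B where B: "\<And>n. \<bar>a n\<bar> \<le> B"
    using assms(1) by (auto simp: Bseq_def)
  have "norm (a n / real (n + 1) ^ m * x ^ n) \<le> B * \<bar>x\<bar> ^ n" for n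
  proof -
    have "\<bar>a n / real (n + 1) ^ m\<bar> \<le> \<bar>a n\<bar> / 1"
      unfolding abs_divide by (rule divide_left_mono) auto
    also have "\<dots> \<le> B"
      using B by simp
    finally have "\<bar>a n / real (n + 1) ^ m\<bar> * \<bar>x\<bar> ^ n \<le> B * \<bar>x\<bar> ^ n"
      by (rule mult_right_mono) simp
    then show ?thesis
      by (simp only: real_norm_def abs_mult power_abs)
  qed
  moreover have "summable (\<lambda>n. B * \<bar>x\<bar> ^ n)"
    using assms(2) by (simp add: summable_mult summable_geometric)
  ultimately show ?thesis
    by (blast intro: summable_comparison_test'[where g = "\<lambda>n. B * \<bar>x\<bar> ^ n" and N = 0])
qed

lemma weighted_polylog_eq_times_powser:
  assumes "Bseq a" and "\<bar>x\<bar> < 1"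
  shows "weighted_polylog a m x = x * (\<Sum>n. a n / real (n + 1) ^ m * x ^ n)"
proof -
  have "a n * (x ^ (n + 1) / real (n + 1) ^ m) = x * (a n / real (n + 1) ^ m * x ^ n)" for n
    by simp
  then show ?thesis
    unfolding weighted_polylog_def
    by (simp only: suminf_mult[OF summable_bounded_coeffs_powser[OF assms]])
qed

text \<open>
  The derivative is stated through the plain power series, without the factor \<open>x\<close>, so that it is
  also correct at \<open>x = 0\<close>; this is needed on the whole of \<open>(-1, 1)\<close> for the function \<open>G\<close>.
\<close>

lemma weighted_polylog_has_derivative_powser:
  assumes "Bseq a" and "\<bar>x\<bar> < 1"
  shows "(weighted_polylog a (Suc m) has_real_derivative
           (\<Sum>n. a n / real (n + 1) ^ m * x ^ n)) (at x)"
proof -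
  \<comment> \<open>The coefficients of the whole series, whose constant term vanishes.\<close>
  define c where "c n = (if n = 0 then 0 else a (n - 1) / real n ^ Suc m)" for n
  have c_Suc: "c (Suc n) * z ^ Suc n = z * (a n / real (n + 1) ^ Suc m * z ^ n)" for n z
    by (simp add: c_def)
  have summ: "summable (\<lambda>n. c n * z ^ n)" if "norm z < 1" for z :: real
  proof -
    have "summable (\<lambda>n. c (Suc n) * z ^ Suc n)"
      unfolding c_Suc using that assms(1)
      by (intro summable_mult summable_bounded_coeffs_powser) auto
    then show ?thesis
      by (simp only: summable_Suc_iff[where f = "\<lambda>n. c n * z ^ n"])
  qed
  have diffs_c: "diffs c n = a n / real (n + 1) ^ m" for n
    by (simp add: diffs_def c_def del: of_nat_Suc)
  have "((\<lambda>z. \<Sum>n. c n * z ^ n) has_real_derivative (\<Sum>n. diffs c n * x ^ n)) (at x)"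
    by (rule termdiffs_strong'[where K = 1]) (use summ assms(2) in auto)
  then have deriv: "((\<lambda>z. \<Sum>n. c n * z ^ n) has_real_derivative
      (\<Sum>n. a n / real (n + 1) ^ m * x ^ n)) (at x)"
    by (simp only: diffs_c)
  have eq: "(\<Sum>n. c n * z ^ n) = weighted_polylog a (Suc m) z" if "z \<in> {-1<..<1}" for z
  proof -
    have "\<bar>z\<bar> < 1"
      using that by auto
    then have "(\<Sum>n. c n * z ^ n) = (\<Sum>n. c (Suc n) * z ^ Suc n)"
      using suminf_split_head[OF summ[of z]] by (simp add: c_def)
    then show ?thesis
      by (simp add: weighted_polylog_def c_def del: of_nat_Suc)
  qed
  show ?thesis
    by (rule has_field_derivative_transform_within_open[OF deriv, of "{-1<..<1}"])
       (use assms(2) eq in auto)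
qed

lemma weighted_polylog_has_derivative:
  assumes "Bseq a" and "\<bar>x\<bar> < 1" and "x \<noteq> 0"
  shows "(weighted_polylog a (Suc m) has_real_derivative weighted_polylog a m x / x) (at x)"
  using weighted_polylog_has_derivative_powser[OF assms(1,2), of m]
    weighted_polylog_eq_times_powser[OF assms(1,2), of m] assms(3)
  by simp

text \<open>
  For order at least two the terms are dominated on all of \<open>[-1, 1]\<close> by a multiple of
  \<open>1 / (n + 1)^m\<close>. This is what carries convergence and continuity to the end points.
\<close>

lemma weighted_polylog_uniform_bound:
  assumes "Bseq a" and "2 \<le> m"
  obtains M where "summable M"
    and "\<And>n x. \<bar>x\<bar> \<le> 1 \<Longrightarrow> norm (a n * (x ^ (n + 1) / real (n + 1) ^ m)) \<le> M n"
proof -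
  obtain B where B: "\<And>n. \<bar>a n\<bar> \<le> B"
    using assms(1) by (auto simp: Bseq_def)
  have "summable (\<lambda>n. inverse (real (n + 1) ^ m))"
    using inverse_power_summable[OF assms(2), where 'a = real]
    by (subst (asm) summable_Suc_iff [symmetric]) simp
  then have "summable (\<lambda>n. B * inverse (real (n + 1) ^ m))"
    by (rule summable_mult)
  moreover have "norm (a n * (x ^ (n + 1) / real (n + 1) ^ m)) \<le> B * inverse (real (n + 1) ^ m)"
    if "\<bar>x\<bar> \<le> 1" for n x
  proof -
    have "\<bar>x\<bar> ^ (n + 1) \<le> 1"
      using that by (intro power_le_one) auto
    then have "\<bar>x\<bar> ^ (n + 1) / real (n + 1) ^ m \<le> 1 / real (n + 1) ^ m"
      by (intro divide_right_mono) auto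
    then have "\<bar>a n\<bar> * (\<bar>x\<bar> ^ (n + 1) / real (n + 1) ^ m) \<le> B * (1 / real (n + 1) ^ m)"
      using B[of n] by (intro mult_mono) auto
    then show ?thesis
      by (simp add: abs_mult power_abs divide_inverse)
  qed
  ultimately show thesis
    by (rule that)
qed

lemma summable_weighted_polylog:
  assumes "Bseq a" and "2 \<le> m" and "\<bar>x\<bar> \<le> 1"
  shows "summable (\<lambda>n. a n * (x ^ (n + 1) / real (n + 1) ^ m))"
proof -
  obtain M where "summable M"
    and "\<And>n x. \<bar>x\<bar> \<le> 1 \<Longrightarrow> norm (a n * (x ^ (n + 1) / real (n + 1) ^ m)) \<le> M n"
    using weighted_polylog_uniform_bound[OF assms(1,2)] by metis
  then show ?thesis
    using assms(3) by (blast intro: summable_comparison_test'[of M 0])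
qed

lemma continuous_on_weighted_polylog:
  assumes "Bseq a" and "2 \<le> m"
  shows "continuous_on {-1..1} (weighted_polylog a m)"
proof -
  obtain M where M: "summable M"
    "\<And>n x. \<bar>x\<bar> \<le> 1 \<Longrightarrow> norm (a n * (x ^ (n + 1) / real (n + 1) ^ m)) \<le> M n"
    using weighted_polylog_uniform_bound[OF assms] by metis
  have "uniform_limit {-1..1} (\<lambda>n x. \<Sum>i<n. a i * (x ^ (i + 1) / real (i + 1) ^ m))
          (weighted_polylog a m) sequentially"
    unfolding weighted_polylog_def by (rule Weierstrass_m_test[OF M(2) M(1)]) auto
  then show ?thesis
    by (rule uniform_limit_theorem[rotated])
       (auto intro!: always_eventually continuous_intros simp del: of_nat_Suc)
qed

section \<open>Dilogarithm and trilogarithm\<close>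

lemma continuous_on_Li [continuous_intros]:
  assumes "continuous_on S f" and "\<And>x. x \<in> S \<Longrightarrow> \<bar>f x\<bar> \<le> 1" and "2 \<le> m"
  shows "continuous_on S (\<lambda>x. Li m (f x))"
proof -
  have "continuous_on {-1..1} (Li m)"
    using continuous_on_weighted_polylog[of "\<lambda>_. 1" m] assms(3)
    by (simp add: Li_eq_weighted_polylog [abs_def])
  moreover have "f ` S \<subseteq> {-1..1}"
    using assms(2) by (force simp: abs_le_iff)
  ultimately show ?thesis
    using continuous_on_compose2[OF _ assms(1)] by blast
qed

lemma Li_1:
  assumes "\<bar>x\<bar> < 1"
  shows "Li 1 x = - ln (1 - x)"
proof -
  have "(\<lambda>n. - ((- (- x)) ^ n) / of_nat n) sums ln (1 + (- x))"
    using ln_series'[of "- x"] assms by simp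
  then have "(\<lambda>n. - (x ^ n / of_nat n)) sums ln (1 - x)"
    by simp
  then have "(\<lambda>n. x ^ n / of_nat n) sums (- ln (1 - x))"
    using sums_minus by fastforce
  then have "(\<lambda>n. x ^ Suc n / of_nat (Suc n)) sums (- ln (1 - x))"
    by (subst sums_Suc_iff) simp
  then show ?thesis
    by (simp add: Li_def sums_iff)
qed

lemma Li_has_derivative:
  assumes "(f has_real_derivative f') (at x)" and "\<bar>f x\<bar> < 1" and "f x \<noteq> 0"
  shows "((\<lambda>x. Li (Suc m) (f x)) has_real_derivative Li m (f x) / f x * f') (at x)"
proof (rule DERIV_chain2[OF _ assms(1)])
  show "(Li (Suc m) has_real_derivative Li m (f x) / f x) (at (f x))"
    using weighted_polylog_has_derivative[of "\<lambda>_. 1" "f x" m] assms(2,3)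
    by (simp add: Li_eq_weighted_polylog [abs_def, symmetric])
qed

text \<open>
  The three rational substitutions that occur have simple logarithmic derivatives: \<open>1 / (1 + x)\<close>
  here, and \<open>1 / (x (1 + x))\<close> for the two Moebius transformations below. The bound \<open>-1/3 < x\<close>
  keeps \<open>2 x / (1 + x)\<close> above \<open>-1\<close>.
\<close>

lemma Li_half_has_derivative:
  assumes "\<bar>x\<bar> < 1"
  shows "((\<lambda>x. Li (Suc m) ((1 + x) / 2)) has_real_derivative Li m ((1 + x) / 2) / (1 + x)) (at x)"
proof (rule DERIV_cong[OF Li_has_derivative])
  show "((\<lambda>x. (1 + x) / 2) has_real_derivative 1 / 2) (at x)"
    by (auto intro!: derivative_eq_intros)
  \<comment> \<open>Stated for an arbitrary factor so that simplification leaves the argument of \<open>Li\<close> alone.\<close>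
  have "L / ((1 + x) / 2) * (1 / 2) = L / (1 + x)" for L
    using assms by (simp add: field_simps)
  then show "Li m ((1 + x) / 2) / ((1 + x) / 2) * (1 / 2) =
      Li m ((1 + x) / 2) / (1 + x)" .
qed (use assms in \<open>auto simp: abs_less_iff\<close>)

lemma Li_double_Moebius_has_derivative:
  assumes "- (1 / 3) < x" and "x < 1" and "x \<noteq> 0"
  shows "((\<lambda>x. Li (Suc m) (2 * x / (1 + x))) has_real_derivative
           Li m (2 * x / (1 + x)) / (x * (1 + x))) (at x)"
proof (rule DERIV_cong[OF Li_has_derivative])
  show "((\<lambda>x. 2 * x / (1 + x)) has_real_derivative 2 / (1 + x)\<^sup>2) (at x)"
    using assms by (auto intro!: derivative_eq_intros simp: power2_eq_square divide_simps)
  have "L / (2 * x / (1 + x)) * (2 / (1 + x)\<^sup>2) = L / (x * (1 + x))" for L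
    using assms by (simp add: divide_simps power2_eq_square)
  then show "Li m (2 * x / (1 + x)) / (2 * x / (1 + x)) * (2 / (1 + x)\<^sup>2) =
      Li m (2 * x / (1 + x)) / (x * (1 + x))" .
  show "\<bar>2 * x / (1 + x)\<bar> < 1"
    using assms by (auto simp: abs_less_iff divide_simps)
qed (use assms in auto)

lemma Li_Moebius_has_derivative:
  assumes "- (1 / 3) < x" and "x < 1" and "x \<noteq> 0"
  shows "((\<lambda>x. Li (Suc m) (x / (1 + x))) has_real_derivative
           Li m (x / (1 + x)) / (x * (1 + x))) (at x)"
proof (rule DERIV_cong[OF Li_has_derivative])
  show "((\<lambda>x. x / (1 + x)) has_real_derivative 1 / (1 + x)\<^sup>2) (at x)"
    using assms by (auto intro!: derivative_eq_intros simp: power2_eq_square divide_simps)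
  have "L / (x / (1 + x)) * (1 / (1 + x)\<^sup>2) = L / (x * (1 + x))" for L
    using assms by (simp add: divide_simps power2_eq_square)
  then show "Li m (x / (1 + x)) / (x / (1 + x)) * (1 / (1 + x)\<^sup>2) =
      Li m (x / (1 + x)) / (x * (1 + x))" .
  show "\<bar>x / (1 + x)\<bar> < 1"
    using assms by (auto simp: abs_less_iff divide_simps)
qed (use assms in auto)

lemma ln_1_plus_has_derivative:
  fixes x :: real
  assumes "- 1 < x"
  shows "((\<lambda>x. ln (1 + x)) has_real_derivative 1 / (1 + x)) (at x)"
  using assms by (auto intro!: derivative_eq_intros)

text \<open>
  For each of these arguments \<open>u\<close>, \<open>1 - u\<close> is a quotient of \<open>1 - x\<close>, \<open>1 + x\<close>, \<open>1\<close> and \<open>2\<close>, so that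
  the derivatives of the dilogarithms only involve \<open>ln (1 - x)\<close>, \<open>ln (1 + x)\<close> and \<open>ln 2\<close>.
\<close>

lemma Li_1_half:
  assumes "\<bar>x\<bar> < 1"
  shows "Li 1 ((1 + x) / 2) = ln 2 - ln (1 - x)"
proof -
  have "1 - (1 + x) / 2 = (1 - x) / 2"
    by (simp add: field_simps)
  moreover have "\<bar>(1 + x) / 2\<bar> < 1"
    using assms by (auto simp: abs_less_iff)
  ultimately have "Li 1 ((1 + x) / 2) = - ln ((1 - x) / 2)"
    by (simp only: Li_1)
  then show ?thesis
    using assms by (simp add: ln_div)
qed

lemma Li_1_double_Moebius:
  assumes "- (1 / 3) < x" and "x < 1"
  shows "Li 1 (2 * x / (1 + x)) = ln (1 + x) - ln (1 - x)"
proof -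
  have "1 - 2 * x / (1 + x) = (1 - x) / (1 + x)"
    using assms by (simp add: field_simps)
  moreover have "\<bar>2 * x / (1 + x)\<bar> < 1"
    using assms by (auto simp: abs_less_iff divide_simps)
  ultimately have "Li 1 (2 * x / (1 + x)) = - ln ((1 - x) / (1 + x))"
    by (simp only: Li_1)
  then show ?thesis
    using assms by (simp add: ln_div)
qed

lemma Li_1_Moebius:
  assumes "- (1 / 3) < x" and "x < 1"
  shows "Li 1 (x / (1 + x)) = ln (1 + x)"
proof -
  have "1 - x / (1 + x) = 1 / (1 + x)"
    using assms by (simp add: field_simps)
  moreover have "\<bar>x / (1 + x)\<bar> < 1"
    using assms by (auto simp: abs_less_iff divide_simps)
  ultimately have "Li 1 (x / (1 + x)) = - ln (1 / (1 + x))"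
    by (simp only: Li_1)
  then show ?thesis
    using assms by (simp add: ln_div)
qed

text \<open>
  The exceptional set absorbs the point \<open>0\<close>, where the formula \<open>Li m x / x\<close> for the derivative of a
  polylogarithm breaks down.
\<close>

lemma has_real_derivative_zero_off_finite_unique:
  fixes f :: "real \<Rightarrow> real"
  assumes "finite K" and "continuous_on {a..b} f" and "c \<in> {a..b}" and "x \<in> {a..b}"
    and "\<And>t. a < t \<Longrightarrow> t < b \<Longrightarrow> t \<notin> K \<Longrightarrow> (f has_real_derivative 0) (at t)"
  shows "f x = f c"
proof -
  have deriv: "(f has_derivative (\<lambda>h. 0)) (at t within {a..b})" if "t \<in> {a..b} - (K \<union> {a, b})" for t
  proof -
    have "(f has_real_derivative 0) (at t)"
      using that by (intro assms(5)) auto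
    then have "(f has_derivative (\<lambda>h. 0 * h)) (at t)"
      by (rule has_field_derivative_imp_has_derivative)
    then show ?thesis
      by (simp add: has_derivative_at_withinI)
  qed
  have "f t = f a" if "t \<in> {a..b}" for t
  proof (rule has_derivative_zero_unique_strong_interval[where a = a and b = b and f = f])
    show "finite (K \<union> {a, b})"
      using assms(1) by simp
  qed (fact assms(2) refl deriv that)+
  from this[OF assms(3)] this[OF assms(4)] show ?thesis
    by simp
qed

text \<open>
  Both sides vanish at \<open>0\<close> and have derivative \<open>ln (1 - x) / (1 + x)\<close>. On the left, the first two
  terms contribute \<open>- ln (1 - x) / (x (1 + x))\<close> and the third \<open>ln (1 - x) / x\<close>.
\<close>

lemma dilogarithm_identity:
  fixes x :: real
  assumes "- (1 / 3) \<le> x" and "x \<le> 1"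
  shows "Li 2 (2 * x / (1 + x)) - Li 2 (x / (1 + x)) - Li 2 x
       = ln 2 * ln (1 + x) - Li 2 ((1 + x) / 2) + Li 2 (1 / 2)"
proof -
  define f where "f t = Li 2 (2 * t / (1 + t)) - Li 2 (t / (1 + t)) - Li 2 t
      - (ln 2 * ln (1 + t) - Li 2 ((1 + t) / 2) + Li 2 (1 / 2))" for t :: real
  have cont: "continuous_on {- (1 / 3)..1} f"
    unfolding f_def by (intro continuous_intros) (auto simp: abs_le_iff field_simps)
  have "(f has_real_derivative 0) (at t)" if "- (1 / 3) < t" "t < 1" "t \<notin> {0}" for t
  proof -
    have t0: "t \<noteq> 0"
      using that(3) by simp
    have t: "\<bar>t\<bar> < 1" and t1: "- 1 < t"
      using that by auto
    note derivs = Li_double_Moebius_has_derivative[OF that(1,2) t0, of 1]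
      Li_Moebius_has_derivative[OF that(1,2) t0, of 1] Li_has_derivative[OF DERIV_ident t t0, of 1]
      ln_1_plus_has_derivative[OF t1] Li_half_has_derivative[OF t, of 1]
    \<comment> \<open>The summand \<open>0\<close> and the factor \<open>1\<close> keep the shape that the differentiation rules produce.\<close>
    have "(f has_real_derivative
        Li 1 (2 * t / (1 + t)) / (t * (1 + t)) - Li 1 (t / (1 + t)) / (t * (1 + t)) - Li 1 t / t * 1
        - (ln 2 * (1 / (1 + t)) - Li 1 ((1 + t) / 2) / (1 + t) + 0)) (at t)"
      unfolding f_def Suc_1 [symmetric]
      by (rule DERIV_diff DERIV_add DERIV_cmult DERIV_const derivs)+
    moreover have "Li 1 (2 * t / (1 + t)) / (t * (1 + t)) - Li 1 (t / (1 + t)) / (t * (1 + t))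
        - Li 1 t / t * 1 - (ln 2 * (1 / (1 + t)) - Li 1 ((1 + t) / 2) / (1 + t) + 0) = 0"
      unfolding Li_1_double_Moebius[OF that(1,2)] Li_1_Moebius[OF that(1,2)] Li_1_half[OF t] Li_1[OF t]
      using that by (simp add: divide_simps) (simp add: algebra_simps)
    ultimately show ?thesis
      by simp
  qed
  then have "f x = f 0"
    using cont assms
    by (intro has_real_derivative_zero_off_finite_unique[of "{0}" "- (1 / 3)" 1 f 0 x]) auto
  then show ?thesis
    by (simp add: f_def)
qed

section \<open>Generating functions of the skew-harmonic numbers\<close>

lemma skew_harm_0 [simp]: "skew_harm 0 = 0"
  by (simp add: skew_harm_def)

lemma skew_harm_Suc: "skew_harm (Suc n) = skew_harm n + (-1) ^ n / real (Suc n)"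
  by (simp add: skew_harm_def)

lemma Bseq_skew_harm: "Bseq skew_harm"
proof -
  \<comment> \<open>The skew-harmonic numbers are the partial sums of a convergent series.\<close>
  have "skew_harm n = (\<Sum>k<n. (-1) ^ k / real (Suc k))" for n
    by (induction n) (simp_all add: skew_harm_Suc)
  then have "skew_harm \<longlonglongrightarrow> ln 2"
    using alternating_harmonic_series_sums unfolding sums_def by presburger
  then show ?thesis
    by (intro convergent_imp_Bseq convergentI)
qed

text \<open>
  Multiplying the series by \<open>1 - x\<close> replaces its coefficients by their differences
  \<open>H (n + 1) - H n = (-1)^n / (n + 1)\<close>, which are those of \<open>ln (1 + x)\<close>.
\<close>

lemma skew_harm_powser:
  fixes x :: real
  assumes "\<bar>x\<bar> < 1"
  shows "(\<Sum>n. skew_harm n * x ^ n) = ln (1 + x) / (1 - x)"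
proof -
  define S where "S = (\<Sum>n. skew_harm n * x ^ n)"
  have sums: "(\<lambda>n. skew_harm n * x ^ n) sums S"
    using summable_bounded_coeffs_powser[OF Bseq_skew_harm assms, of 0]
    by (simp add: S_def summable_sums)
  then have "(\<lambda>n. skew_harm (Suc n) * x ^ Suc n) sums S"
    by (subst sums_Suc_iff) simp
  from sums_diff[OF this sums_mult[OF sums, of x]]
  have "(\<lambda>n. (-1) ^ n * x ^ Suc n / real (Suc n)) sums (S - x * S)"
    by (simp add: skew_harm_Suc algebra_simps)
  moreover have "(\<lambda>n. (-1) ^ n * x ^ Suc n / real (Suc n)) sums ln (1 + x)"
  proof -
    have "(\<lambda>n. - ((- x) ^ Suc n) / real (Suc n)) sums ln (1 + x)"
      using ln_series'[OF assms] by (subst sums_Suc_iff) simp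
    moreover have "- ((- x) ^ Suc n) = (-1) ^ n * x ^ Suc n" for n
      by (subst power_minus) simp
    ultimately show ?thesis
      by (simp only:)
  qed
  ultimately have "S - x * S = ln (1 + x)"
    by (rule sums_unique2)
  then show ?thesis
    using assms by (simp add: S_def field_simps)
qed

text \<open>
  This integrates \<open>ln (1 + x) / (1 - x)\<close>: integration by parts produces the product of logarithms, and
  the remaining integrand \<open>(ln (1 - x) - ln 2) / (1 + x)\<close> is the derivative of \<open>- Li 2 ((1 + x) / 2)\<close>.
\<close>

lemma skew_harm_weighted_polylog_1:
  fixes x :: real
  assumes "\<bar>x\<bar> < 1"
  shows "weighted_polylog skew_harm 1 x
       = ln (1 + x) * (ln 2 - ln (1 - x)) - Li 2 ((1 + x) / 2) + Li 2 (1 / 2)"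
proof -
  define f where "f t = weighted_polylog skew_harm 1 t
      - (ln (1 + t) * (ln 2 - ln (1 - t)) - Li 2 ((1 + t) / 2) + Li 2 (1 / 2))" for t
  have "(f has_real_derivative 0) (at t within {-1<..<1})" if "t \<in> {-1<..<1}" for t
  proof -
    have t: "\<bar>t\<bar> < 1" and t1: "- 1 < t"
      using that by auto
    have G: "(weighted_polylog skew_harm 1 has_real_derivative ln (1 + t) / (1 - t)) (at t)"
      using weighted_polylog_has_derivative_powser[OF Bseq_skew_harm t, of 0] skew_harm_powser[OF t]
      by simp
    have "((\<lambda>t. ln 2 - ln (1 - t)) has_real_derivative 1 / (1 - t)) (at t)"
      using that by (auto intro!: derivative_eq_intros)
    note derivs = this G ln_1_plus_has_derivative[OF t1] Li_half_has_derivative[OF t, of 1]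
    have "(f has_real_derivative ln (1 + t) / (1 - t)
        - ((1 / (1 + t)) * (ln 2 - ln (1 - t)) + 1 / (1 - t) * ln (1 + t)
           - Li 1 ((1 + t) / 2) / (1 + t) + 0)) (at t)"
      unfolding f_def Suc_1 [symmetric]
      by (rule DERIV_diff DERIV_add DERIV_mult DERIV_const derivs)+
    moreover have "ln (1 + t) / (1 - t)
        - ((1 / (1 + t)) * (ln 2 - ln (1 - t)) + 1 / (1 - t) * ln (1 + t)
           - Li 1 ((1 + t) / 2) / (1 + t) + 0) = 0"
      unfolding Li_1_half[OF t] by simp
    ultimately show ?thesis
      by (auto intro: has_field_derivative_at_within)
  qed
  then obtain c where c: "\<And>t. t \<in> {-1<..<1} \<Longrightarrow> f t = c"
    using has_field_derivative_zero_constant[of "{-1<..<1}" f] by auto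
  have "f x = f 0"
    using c[of x] c[of 0] assms by (simp add: abs_less_iff)
  then show ?thesis
    by (simp add: f_def)
qed

section \<open>The closed form\<close>

text \<open>
  The derivative of the left side is \<open>G x / x\<close>. In the derivative of the right side the difference of
  the dilogarithms at \<open>2 x / (1 + x)\<close> and \<open>x / (1 + x)\<close> appears over \<open>x (1 + x)\<close>; substituting the
  dilogarithm identity for it and splitting \<open>1 / (x (1 + x))\<close> as \<open>1 / x - 1 / (1 + x)\<close> gives \<open>G x / x\<close>.
\<close>

lemma skew_harm_weighted_polylog_2:
  fixes x :: real
  assumes "- (1 / 3) \<le> x" and "x \<le> 1"
  shows "weighted_polylog skew_harm 2 x =
    Li 3 (2 * x / (1 + x)) - Li 3 (x / (1 + x)) - Li 3 ((1 + x) / 2) + Li 3 (1 / 2) - Li 3 x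
      + ln (1 + x) * (Li 2 x + Li 2 (1 / 2) + 1 / 2 * ln 2 * ln (1 + x))"
proof -
  define R where "R t = Li 3 (2 * t / (1 + t)) - Li 3 (t / (1 + t)) - Li 3 ((1 + t) / 2)
      + Li 3 (1 / 2) - Li 3 t
      + ln (1 + t) * (Li 2 t + Li 2 (1 / 2) + 1 / 2 * ln 2 * ln (1 + t))" for t
  define f where "f t = weighted_polylog skew_harm 2 t - R t" for t
  have "continuous_on {- (1 / 3)..1} (weighted_polylog skew_harm 2)"
    by (rule continuous_on_subset[OF continuous_on_weighted_polylog[OF Bseq_skew_harm]]) auto
  moreover have "continuous_on {- (1 / 3)..1} R"
    unfolding R_def by (intro continuous_intros) (auto simp: abs_le_iff field_simps)
  ultimately have cont: "continuous_on {- (1 / 3)..1} f"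
    unfolding f_def by (intro continuous_intros)
  have "(f has_real_derivative 0) (at t)" if "- (1 / 3) < t" "t < 1" "t \<notin> {0}" for t
  proof -
    have t0: "t \<noteq> 0"
      using that(3) by simp
    have t: "\<bar>t\<bar> < 1" and t1: "- 1 < t"
      using that by auto
    have Suc_2: "3 = Suc 2"
      by simp
    let ?G = "ln (1 + t) * (ln 2 - ln (1 - t)) - Li 2 ((1 + t) / 2) + Li 2 (1 / 2)"
    have F: "(weighted_polylog skew_harm 2 has_real_derivative ?G / t) (at t)"
      using weighted_polylog_has_derivative[OF Bseq_skew_harm t t0, of 1]
      unfolding Suc_1 skew_harm_weighted_polylog_1[OF t] .
    have L2: "(Li 2 has_real_derivative - ln (1 - t) / t) (at t)"
      using Li_has_derivative[OF DERIV_ident t, of 1] that Li_1[OF t]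
      by (simp add: numeral_2_eq_2)
    define u1 u2 u3 where "u1 = Li 2 (2 * t / (1 + t))" and "u2 = Li 2 (t / (1 + t))"
      and "u3 = Li 2 ((1 + t) / 2)"
    note derivs = L2 ln_1_plus_has_derivative[OF t1]
      Li_double_Moebius_has_derivative[OF that(1,2) t0, of 2, folded Suc_2]
      Li_Moebius_has_derivative[OF that(1,2) t0, of 2, folded Suc_2]
      Li_has_derivative[OF DERIV_ident t t0, of 2, folded Suc_2]
      Li_half_has_derivative[OF t, of 2, folded Suc_2]
    have R: "(R has_real_derivative u1 / (t * (1 + t)) - u2 / (t * (1 + t)) - u3 / (1 + t) + 0
        - Li 2 t / t * 1
        + ((1 / (1 + t)) * (Li 2 t + Li 2 (1 / 2) + 1 / 2 * ln 2 * ln (1 + t))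
           + (- ln (1 - t) / t + 0 + 1 / 2 * ln 2 * (1 / (1 + t))) * ln (1 + t))) (at t)"
      unfolding R_def u1_def u2_def u3_def
      by (rule DERIV_diff DERIV_add DERIV_const derivs DERIV_cmult DERIV_mult)+
    have u1: "u1 = u2 + Li 2 t + ln 2 * ln (1 + t) - u3 + Li 2 (1 / 2)"
      using dilogarithm_identity[of t] that by (simp add: u1_def u2_def u3_def)
    have "u1 / (t * (1 + t)) - u2 / (t * (1 + t)) - u3 / (1 + t) + 0
        - Li 2 t / t * 1
        + ((1 / (1 + t)) * (Li 2 t + Li 2 (1 / 2) + 1 / 2 * ln 2 * ln (1 + t))
           + (- ln (1 - t) / t + 0 + 1 / 2 * ln 2 * (1 / (1 + t))) * ln (1 + t)) = ?G / t"
      unfolding u1 u3_def [symmetric]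
      using that by (simp add: divide_simps) (simp add: algebra_simps)
    then show ?thesis
      unfolding f_def using DERIV_diff[OF F R] by simp
  qed
  then have "f x = f 0"
    using cont assms
    by (intro has_real_derivative_zero_off_finite_unique[of "{0}" "- (1 / 3)" 1 f 0 x]) auto
  then show ?thesis
    by (simp add: f_def R_def)
qed

theorem proposition9:
  fixes x :: real
  assumes "- (1 / 3) \<le> x" and "x \<le> 1"
  shows "(\<lambda>n. skew_harm (n + 1) * (x ^ (n + 2) / real (n + 2) ^ 2)) sums
    (Li 3 (2 * x / (1 + x)) - Li 3 (x / (1 + x)) - Li 3 ((1 + x) / 2) + Li 3 (1 / 2) - Li 3 x
      + ln (1 + x) * (Li 2 x + Li 2 (1 / 2) + 1 / 2 * ln 2 * ln (1 + x)))"
proof -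
  let ?g = "\<lambda>n. skew_harm n * (x ^ (n + 1) / real (n + 1) ^ 2)"
  have "summable ?g"
    using assms by (intro summable_weighted_polylog Bseq_skew_harm) auto
  then have "?g sums weighted_polylog skew_harm 2 x"
    unfolding weighted_polylog_def by (rule summable_sums)
  \<comment> \<open>The term of index \<open>0\<close> vanishes because \<open>skew_harm 0\<close> is the empty sum.\<close>
  then have "(\<lambda>n. ?g (Suc n)) sums weighted_polylog skew_harm 2 x"
    by (subst sums_Suc_iff) simp
  then show ?thesis
    unfolding skew_harm_weighted_polylog_2[OF assms] by (simp add: add_ac)
qed

end
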